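(* Let $(X,d,\mu)$ be a metric measure space such that $(X,d)$ is $D$-geometrically doubling and $\mu$ satisfies a local comparability condition. If either all balls of $X$ are connected, or $X$ is quasiconvex, or $X$ has the approximate midpoint property, then $\mu$ is doubling.
   Context: $B(x,r)=\{y\in X: d(x,y)<r\}$ denotes the open ball. A metric measure space $(X,d,\mu)$ is a metric space $(X,d)$ with a Borel measure $\mu$, not identically zero, such that $\mu(B(x,r))<\infty$ for all balls and $\mu$ is $\tau$-smooth: for every collection $\{U_\alpha\}_{\alpha\in\Lambda}$ of open sets, $\mu(\bigcup_\alpha U_\alpha)=\sup\mu(\bigcup_{i=1}^n U_{\alpha_i})$, the supremum being over all finite subcollections. $\mu$ satisfies a local comparability condition if there is a constant $C\in[1,\infty)$ such that for all $r>0$ and all $x,y\in X$ with $d(x,y)<r$, $\mu(B(x,r))\le C\mu(B(y,r))$. $(X,d)$ is $D$-geometrically doubling ($D$ a positive integer) if every ball of radius $r$ can be covered with no more than $D$ balls of radius $r/2$. $\mu$ is doubling if there is $C>0$ such that for all $r>0$ and all $x\in X$, $\mu(B(x,2r))\le C\mu(B(x,r))<\infty$. $X$ has the approximate midpoint property if for every $\varepsilon>0$ and every pair of points $x,y$ there is a point $z$ with $d(x,z),d(z,y)<\varepsilon+d(x,y)/2$. $X$ is quasiconvex if there is a constant $C\ge1$ such that every pair of points $x,y$ can be joined by a curve with endpoints $x$ and $y$ of length at most $C\,d(x,y)$. *)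

theory Defs
  imports "HOL-Analysis.Analysis"
begin

text \<open>
  The metric space is a type of class \<open>metric_space\<close>, so that \<open>X\<close> is \<open>UNIV\<close> and \<open>ball x r\<close> is the
  open ball.
\<close>

definition tau_smooth :: "'a::topological_space measure \<Rightarrow> bool" where
  "tau_smooth M \<longleftrightarrow>
     (\<forall>\<U>. (\<forall>U\<in>\<U>. open U) \<longrightarrow>
        emeasure M (\<Union>\<U>) = (SUP \<F>\<in>{\<F>. finite \<F> \<and> \<F> \<subseteq> \<U>}. emeasure M (\<Union>\<F>)))"

definition metric_measure_space :: "'a::metric_space measure \<Rightarrow> bool" where
  "metric_measure_space M \<longleftrightarrow>
     sets M = sets borel \<and>
     (\<exists>A\<in>sets M. emeasure M A \<noteq> 0) \<and>
     (\<forall>x. \<forall>r>0. emeasure M (ball x r) < \<infinity>) \<and>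
     tau_smooth M"

definition local_comparability :: "'a::metric_space measure \<Rightarrow> bool" where
  "local_comparability M \<longleftrightarrow>
     (\<exists>C::real. C \<ge> 1 \<and>
        (\<forall>r>0. \<forall>x y. dist x y < r \<longrightarrow>
           emeasure M (ball x r) \<le> ennreal C * emeasure M (ball y r)))"

definition geometrically_doubling :: "'a::metric_space itself \<Rightarrow> nat \<Rightarrow> bool" where
  "geometrically_doubling _ D \<longleftrightarrow>
     D > 0 \<and>
     (\<forall>x::'a. \<forall>r>0. \<exists>S. finite S \<and> card S \<le> D \<and> ball x r \<subseteq> (\<Union>y\<in>S. ball y (r / 2)))"

definition doubling_measure :: "'a::metric_space measure \<Rightarrow> bool" where
  "doubling_measure M \<longleftrightarrow>
     (\<exists>C::real. C > 0 \<and>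
        (\<forall>r>0. \<forall>x.
           emeasure M (ball x (2 * r)) \<le> ennreal C * emeasure M (ball x r) \<and>
           ennreal C * emeasure M (ball x r) < \<infinity>))"

definition approximate_midpoint_property :: "'a::metric_space itself \<Rightarrow> bool" where
  "approximate_midpoint_property _ \<longleftrightarrow>
     (\<forall>\<epsilon>>0. \<forall>x y::'a. \<exists>z.
        dist x z < \<epsilon> + dist x y / 2 \<and> dist z y < \<epsilon> + dist x y / 2)"

text \<open>
  Length of a curve parametrised by the unit interval: the supremum of the lengths of the
  inscribed polygons over all partitions \<open>0 = t 0 \<le> \<dots> \<le> t n = 1\<close>; it may be infinite.
\<close>

definition curve_length :: "(real \<Rightarrow> 'a::metric_space) \<Rightarrow> ennreal" where
  "curve_length g =
     (SUP (n, t)\<in>{(n::nat, t::nat \<Rightarrow> real). t 0 = 0 \<and> t n = 1 \<and> (\<forall>i<n. t i \<le> t (Suc i))}.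
        ennreal (\<Sum>i<n. dist (g (t i)) (g (t (Suc i)))))"

definition quasiconvex :: "'a::metric_space itself \<Rightarrow> bool" where
  "quasiconvex _ \<longleftrightarrow>
     (\<exists>C::real. C \<ge> 1 \<and>
        (\<forall>x y::'a. \<exists>g. path g \<and> pathstart g = x \<and> pathfinish g = y \<and>
           curve_length g \<le> ennreal (C * dist x y)))"

end

theory Submission
  imports Defs
begin

text \<open>
  Any two points at distance less than \<open>2 * r\<close> lie in a connected set contained in a ball of
  comparable radius, which geometric doubling covers by boundedly many balls of radius \<open>r / 2\<close>.
  Connectedness links the centres of these balls by steps shorter than \<open>r\<close>, so local comparability
  applies a bounded number of times and makes \<open>\<mu>(B(x,r))\<close> and \<open>\<mu>(B(y,r))\<close> uniformly comparable.
  With approximate midpoints two steps suffice. Covering \<open>B(x,2r)\<close> by boundedly many balls of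
  radius \<open>r\<close> centred in it then gives doubling.
\<close>

text \<open>Each further halving replaces every ball of the current cover by at most
  \<open>D\<close> balls, so the count is multiplied by at most \<open>D\<close>. The centres may
  lie outside \<open>ball x r\<close>.\<close>

lemma geometrically_doubling_cover:
  assumes "geometrically_doubling TYPE('a::metric_space) D" and "r > 0"
  shows "\<exists>S::'a set. finite S \<and> card S \<le> D ^ k \<and> ball x r \<subseteq> (\<Union>y\<in>S. ball y (r / 2 ^ k))"
proof (induction k)
  case 0
  show ?case by (rule exI[of _ "{x}"]) simp
next
  case (Suc k)
  then obtain S where S: "finite S" "card S \<le> D ^ k" "ball x r \<subseteq> (\<Union>y\<in>S. ball y (r / 2 ^ k))"
    by blast
  have "r / 2 ^ k > 0"
    using assms(2) by simp
  then have "\<forall>y::'a. \<exists>T. finite T \<and> card T \<le> D \<and> ball y (r / 2 ^ k) \<subseteq> (\<Union>z\<in>T. ball z (r / 2 ^ k / 2))"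
    using assms(1) unfolding geometrically_doubling_def by blast
  then obtain T where T: "\<And>y::'a. finite (T y)" "\<And>y. card (T y) \<le> D"
    "\<And>y. ball y (r / 2 ^ k) \<subseteq> (\<Union>z\<in>T y. ball z (r / 2 ^ k / 2))"
    by metis
  have "card (\<Union>y\<in>S. T y) \<le> (\<Sum>y\<in>S. card (T y))"
    using S(1) by (rule card_UN_le)
  also have "\<dots> \<le> card S * D"
    using sum_bounded_above[of S "\<lambda>y. card (T y)" D] T(2) by simp
  also have "\<dots> \<le> D ^ Suc k"
    using S(2) by simp
  finally have "card (\<Union>y\<in>S. T y) \<le> D ^ Suc k" .
  moreover have "ball x r \<subseteq> (\<Union>z\<in>(\<Union>y\<in>S. T y). ball z (r / 2 ^ Suc k))"
    using S(3) T(3) by (fastforce simp: mult.commute)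
  ultimately show ?case
    using S(1) T(1) by (intro exI[of _ "\<Union>y\<in>S. T y"]) auto
qed

text \<open>The bound spreads from \<open>x\<close> over the centres in \<open>S\<close>, one new
  centre at a time, and connectedness of \<open>A\<close> keeps the spread from stopping early. The
  exponent counts one step from \<open>x\<close> to a first centre, at most \<open>N - 1\<close>
  steps to reach the others, and one step to \<open>y\<close>. In the application \<open>f z\<close>
  is the measure of \<open>ball z r\<close>.\<close>

lemma comparable_on_connected:
  fixes f :: "'a::metric_space \<Rightarrow> ennreal" and C :: real
  assumes C: "C \<ge> 1"
    and step: "\<And>a b. dist a b < r \<Longrightarrow> f b \<le> ennreal C * f a"
    and A: "connected A" "x \<in> A" "y \<in> A"
    and S: "finite S" "card S \<le> N" "A \<subseteq> (\<Union>s\<in>S. ball s (r / 2))"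
  shows "f y \<le> ennreal (C ^ Suc N) * f x"
proof -
  have near: "dist a b < r" if "dist a p < r / 2" "dist b p < r / 2" for a b p :: 'a
    using dist_triangle2[of a b p] that by linarith
  have C_mono: "ennreal (C ^ m) * u \<le> ennreal (C ^ n) * u" if "m \<le> n" for m n u
    using C that by (intro mult_right_mono ennreal_leI power_increasing) auto
  have step_pow: "f b \<le> ennreal (C ^ Suc n) * f x"
    if "dist a b < r" "f a \<le> ennreal (C ^ n) * f x" for a b n
  proof -
    have "f b \<le> ennreal C * f a" using step that(1) .
    also have "\<dots> \<le> ennreal C * (ennreal (C ^ n) * f x)"
      using that(2) by (rule mult_left_mono) simp
    finally show ?thesis using C by (simp add: ennreal_mult mult.assoc)
  qed
  \<comment> \<open>Only balls that meet \<open>A\<close> are kept, so any nonempty subfamily has a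
    union meeting \<open>A\<close>, as the connectedness argument requires.\<close>
  define S' where "S' = {s\<in>S. ball s (r / 2) \<inter> A \<noteq> {}}"
  have fin: "finite S'" and card_le: "card S' \<le> N"
    using S card_mono[of S S'] by (auto simp: S'_def)
  have cover: "A \<subseteq> (\<Union>s\<in>S'. ball s (r / 2))"
    using S(3) unfolding S'_def by blast
  \<comment> \<open>The induction counts the centres already reached, so no explicit chain is built.
    Since \<open>C \<ge> 1\<close>, bounds of earlier stages can be weakened to the current
    exponent.\<close>
  have grow: "\<exists>T\<subseteq>S'. card T = Suc n \<and> (\<forall>s\<in>T. f s \<le> ennreal (C ^ Suc n) * f x)"
    if "Suc n \<le> card S'" for n
    using that
  proof (induction n)
    case 0
    obtain s where "s \<in> S'" "dist s x < r / 2"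
      using cover A(2) by auto
    \<comment> \<open>From \<open>0 \<le> dist s x < r / 2\<close> it follows that
      \<open>r > 0\<close>, hence \<open>r / 2 < r\<close>.\<close>
    moreover from this have "dist x s < r"
      using zero_le_dist[of s x] by (simp only: dist_commute[of x s])
    ultimately show ?case
      using step by (intro exI[of _ "{s}"]) auto
  next
    case (Suc n)
    then obtain T where T: "T \<subseteq> S'" "card T = Suc n" "\<forall>s\<in>T. f s \<le> ennreal (C ^ Suc n) * f x"
      by auto
    \<comment> \<open>Balls around reached and unreached centres form two open sets that cover
      \<open>A\<close> and both meet it, so they share a point \<open>p\<close>. Through
      \<open>p\<close> some unreached \<open>t\<close> is closer than \<open>r\<close> to a reached
      \<open>s\<close>.\<close>
    let ?U = "\<Union>s\<in>T. ball s (r / 2)" and ?V = "\<Union>s\<in>S' - T. ball s (r / 2)"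
    have "S' - T \<noteq> {}" "T \<noteq> {}"
      using T Suc.prems by auto
    then have "?U \<inter> A \<noteq> {}" "?V \<inter> A \<noteq> {}"
      using T(1) unfolding S'_def by blast+
    moreover have "A \<subseteq> ?U \<union> ?V"
      using cover by blast
    ultimately obtain p where "p \<in> ?U" "p \<in> ?V"
      using connectedD[OF A(1), of ?U ?V] by blast
    then obtain s t where st: "s \<in> T" "t \<in> S' - T" "dist s p < r / 2" "dist t p < r / 2"
      unfolding UN_iff mem_ball by blast
    have "f t \<le> ennreal (C ^ Suc (Suc n)) * f x"
      using step_pow near st T(3) by blast
    moreover have "f s \<le> ennreal (C ^ Suc (Suc n)) * f x" if "s \<in> T" for s
      using order_trans[OF bspec[OF T(3) that] C_mono[of "Suc n" "Suc (Suc n)"]] by simp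
    moreover have "card (insert t T) = Suc (Suc n)"
      using T st(2) fin by (metis DiffD2 card_insert_disjoint finite_subset)
    ultimately show ?case
      using T(1) st(2) by (intro exI[of _ "insert t T"]) auto
  qed
  obtain s where s: "s \<in> S'" "dist s y < r / 2"
    using cover A(3) by auto
  then have "card S' > 0"
    using fin by (auto simp: card_gt_0_iff)
  \<comment> \<open>At the last stage the reached set has the cardinality of \<open>S'\<close> and
    therefore equals it, so it contains \<open>s\<close>.\<close>
  then have "f s \<le> ennreal (C ^ card S') * f x"
    using grow[of "card S' - 1"] s(1) fin by (auto dest: card_subset_eq)
  then have "f y \<le> ennreal (C ^ Suc (card S')) * f x"
    using step_pow[of s y] s(2) zero_le_dist[of s y] by simp
  also have "\<dots> \<le> ennreal (C ^ Suc N) * f x"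
    using card_le by (intro C_mono) simp
  finally show ?thesis .
qed

lemma dist_le_curve_length:
  assumes "t \<in> {0..1}"
  shows "ennreal (dist (g 0) (g t)) \<le> curve_length g"
proof -
  \<comment> \<open>This is the partition \<open>0, t, 1\<close>, taken with \<open>n = 2\<close>;
    the first side of its polygon is the distance to be bounded.\<close>
  define p :: "nat \<Rightarrow> real" where "p = (\<lambda>i. if i = 0 then 0 else if i = 1 then t else 1)"
  have "ennreal (dist (g 0) (g t)) \<le> ennreal (\<Sum>i<2. dist (g (p i)) (g (p (Suc i))))"
    by (rule ennreal_leI) (simp add: p_def numeral_2_eq_2)
  also have "\<dots> \<le> curve_length g"
    unfolding curve_length_def using assms
    by (intro SUP_upper2[of "(2, p)"]) (auto simp: p_def less_2_cases_iff)
  finally show ?thesis .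
qed

text \<open>The connected set is the image of a curve of length at most \<open>L * dist x y\<close>,
  which stays within \<open>2 * L * r\<close> of \<open>x\<close>. The radius factor is rounded up
  to a power of 2, depending only on \<open>L\<close>, so that repeated halving brings it down to
  \<open>r / 2\<close>.\<close>

lemma quasiconvex_connected:
  assumes "quasiconvex TYPE('a::metric_space)"
  shows "\<exists>k. \<forall>r>0. \<forall>x y::'a. dist x y < 2 * r \<longrightarrow>
           (\<exists>A. connected A \<and> x \<in> A \<and> y \<in> A \<and> A \<subseteq> ball x (2 ^ k * r))"
proof -
  obtain L :: real where L: "L \<ge> 1" and curve: "\<And>x y::'a. \<exists>g. path g \<and> pathstart g = x \<and>
      pathfinish g = y \<and> curve_length g \<le> ennreal (L * dist x y)"
    using assms unfolding quasiconvex_def by blast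
  obtain k where k: "2 * L < 2 ^ k"
    using real_arch_pow[of 2 "2 * L"] by auto
  show ?thesis
  proof (intro exI[of _ k] allI impI)
    fix r :: real and x y :: 'a
    assume r: "r > 0" and xy: "dist x y < 2 * r"
    obtain g where g: "path g" "pathstart g = x" "pathfinish g = y"
      "curve_length g \<le> ennreal (L * dist x y)"
      using curve by blast
    have "dist x (g t) < 2 ^ k * r" if "t \<in> {0..1}" for t
    proof -
      have "ennreal (dist x (g t)) \<le> ennreal (L * dist x y)"
        using order_trans[OF dist_le_curve_length[OF that] g(4)] g(2) by (simp add: pathstart_def)
      then have "dist x (g t) \<le> L * dist x y"
        using L by (subst (asm) ennreal_le_iff) auto
      also have "\<dots> \<le> L * (2 * r)"
        using L xy by (intro mult_left_mono) auto
      also have "\<dots> < 2 ^ k * r"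
        using mult_strict_right_mono[OF k r] by (simp add: mult_ac)
      finally show ?thesis .
    qed
    then have "path_image g \<subseteq> ball x (2 ^ k * r)"
      by (auto simp: path_image_def)
    then show "\<exists>A. connected A \<and> x \<in> A \<and> y \<in> A \<and> A \<subseteq> ball x (2 ^ k * r)"
      using g pathstart_in_path_image pathfinish_in_path_image connected_path_image by metis
  qed
qed

text \<open>Two halvings cover \<open>ball x (2 * r)\<close> by at most \<open>D ^ 2\<close> balls
  of radius \<open>r / 2\<close>, and \<open>K\<close> bounds the contribution of each one.\<close>

lemma doubling_measureI:
  fixes M :: "'a::metric_space measure" and K :: real
  assumes M: "sets M = sets borel" "\<And>x r. r > 0 \<Longrightarrow> emeasure M (ball x r) < \<infinity>"
    and gd: "geometrically_doubling TYPE('a) D"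
    and K: "K > 0" "\<And>r x y. r > 0 \<Longrightarrow> dist x y < 2 * r \<Longrightarrow>
           emeasure M (ball y r) \<le> ennreal K * emeasure M (ball x r)"
  shows "doubling_measure M"
  unfolding doubling_measure_def
proof (intro exI[of _ "real (D ^ 2) * K"] conjI allI impI)
  show "real (D ^ 2) * K > 0"
    using gd K(1) by (simp add: geometrically_doubling_def)
next
  fix r :: real and x :: 'a
  assume r: "r > 0"
  obtain S where S: "finite S" "card S \<le> D ^ 2" "ball x (2 * r) \<subseteq> (\<Union>y\<in>S. ball y (2 * r / 2 ^ 2))"
    using geometrically_doubling_cover[OF gd, of "2 * r" 2 x] r by auto
  \<comment> \<open>A centre \<open>s\<close> may be too far from \<open>x\<close> for
    \<open>K\<close> to apply. Any point \<open>z\<close> of \<open>B s\<close> is within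
    \<open>2 * r\<close> of \<open>x\<close>, and \<open>ball z r\<close> contains
    \<open>B s\<close>, so \<open>z\<close> serves as the new centre.\<close>
  define B where "B s = ball s (r / 2) \<inter> ball x (2 * r)" for s
  have B_sets: "B s \<in> sets M" for s
    using M(1) by (auto simp: B_def)
  have B_le: "emeasure M (B s) \<le> ennreal K * emeasure M (ball x r)" for s
  proof (cases "B s = {}")
    case False
    then obtain z where z: "dist s z < r / 2" "dist x z < 2 * r"
      by (auto simp: B_def)
    have "B s \<subseteq> ball z r"
    proof
      fix w assume "w \<in> B s"
      then show "w \<in> ball z r"
        using z(1) dist_triangle3[of z w s] by (simp add: B_def)
    qed
    then have "emeasure M (B s) \<le> emeasure M (ball z r)"
      using M(1) by (intro emeasure_mono) auto
    also have "\<dots> \<le> ennreal K * emeasure M (ball x r)"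
      using K(2) r z(2) by blast
    finally show ?thesis .
  qed simp
  have "ball x (2 * r) \<subseteq> (\<Union>s\<in>S. B s)"
    using S(3) by (auto simp: B_def)
  then have "emeasure M (ball x (2 * r)) \<le> emeasure M (\<Union>s\<in>S. B s)"
    using S(1) B_sets by (intro emeasure_mono sets.finite_UN) auto
  also have "\<dots> \<le> (\<Sum>s\<in>S. emeasure M (B s))"
    using S(1) B_sets by (intro emeasure_subadditive_finite) auto
  also have "\<dots> \<le> of_nat (card S) * (ennreal K * emeasure M (ball x r))"
    using B_le by (intro sum_bounded_above) auto
  also have "\<dots> \<le> of_nat (D ^ 2) * (ennreal K * emeasure M (ball x r))"
    using S(2) by (intro mult_right_mono of_nat_mono) auto
  also have "\<dots> = ennreal (real (D ^ 2) * K) * emeasure M (ball x r)"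
    using K(1) by (simp add: ennreal_mult ennreal_of_nat_eq_real_of_nat mult.assoc del: of_nat_power)
  finally show "emeasure M (ball x (2 * r)) \<le> ennreal (real (D ^ 2) * K) * emeasure M (ball x r)" .
  show "ennreal (real (D ^ 2) * K) * emeasure M (ball x r) < \<infinity>"
    using M(2)[OF r, of x] by (simp add: ennreal_mult_less_top)
qed

theorem corollary5p8:
  fixes M :: "'a::metric_space measure" and D :: nat
  assumes "metric_measure_space M"
    and "geometrically_doubling TYPE('a) D"
    and "local_comparability M"
    and "(\<forall>x::'a. \<forall>r>0. connected (ball x r)) \<or>
         quasiconvex TYPE('a) \<or>
         approximate_midpoint_property TYPE('a)"
  shows "doubling_measure M"
proof -
  have M: "sets M = sets borel" "\<And>x r. r > 0 \<Longrightarrow> emeasure M (ball x r) < \<infinity>"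
    using assms(1) unfolding metric_measure_space_def by blast+
  obtain C :: real where C: "C \<ge> 1" and comparable: "\<forall>r>0. \<forall>x y. dist x y < r \<longrightarrow>
      emeasure M (ball x r) \<le> ennreal C * emeasure M (ball y r)"
    using assms(3) unfolding local_comparability_def by blast
  have step: "emeasure M (ball y r) \<le> ennreal C * emeasure M (ball x r)"
    if "r > 0" "dist x y < r" for r x y
    using comparable[rule_format, of r y x] that by (simp only: dist_commute[of y x])
  have via_connected: "doubling_measure M"
    if conn: "\<exists>k. \<forall>r>0. \<forall>x y::'a. dist x y < 2 * r \<longrightarrow>
           (\<exists>A. connected A \<and> x \<in> A \<and> y \<in> A \<and> A \<subseteq> ball x (2 ^ k * r))"
  proof -
    from conn obtain k where k: "\<forall>r>0. \<forall>x y::'a. dist x y < 2 * r \<longrightarrow>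
           (\<exists>A. connected A \<and> x \<in> A \<and> y \<in> A \<and> A \<subseteq> ball x (2 ^ k * r))" ..
    show ?thesis
    proof (rule doubling_measureI[OF M assms(2)])
      \<comment> \<open>Going from radius \<open>2 ^ k * r\<close> to \<open>r / 2\<close> takes
        \<open>Suc k\<close> halvings, hence at most \<open>N = D ^ Suc k\<close> centres.\<close>
      show "C ^ Suc (D ^ Suc k) > 0"
        using C by simp
    next
      fix r :: real and x y :: 'a
      assume r: "r > 0" and xy: "dist x y < 2 * r"
      obtain A where A: "connected A" "x \<in> A" "y \<in> A" "A \<subseteq> ball x (2 ^ k * r)"
        using k[rule_format, OF r xy] by blast
      obtain S where S: "finite S" "card S \<le> D ^ Suc k"
        "ball x (2 ^ k * r) \<subseteq> (\<Union>s\<in>S. ball s (2 ^ k * r / 2 ^ Suc k))"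
        using geometrically_doubling_cover[OF assms(2), of "2 ^ k * r" "Suc k" x] r by auto
      have "A \<subseteq> (\<Union>s\<in>S. ball s (r / 2))"
        using A(4) S(3) by simp
      then show "emeasure M (ball y r) \<le> ennreal (C ^ Suc (D ^ Suc k)) * emeasure M (ball x r)"
        using comparable_on_connected[where f = "\<lambda>z. emeasure M (ball z r)" and r = r]
          C step[OF r] A(1-3) S(1,2) by blast
    qed auto
  qed
  from assms(4) show ?thesis
  proof (elim disjE)
    assume "\<forall>x::'a. \<forall>r>0. connected (ball x r)"
    then show ?thesis
      \<comment> \<open>With \<open>k = 1\<close> the connected set is \<open>ball x (2 * r)\<close>
        itself.\<close>
      by (intro via_connected exI[of _ 1] allI impI) (rule_tac x = "ball x (2 * r)" in exI, simp)
  next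
    assume "quasiconvex TYPE('a)"
    then show ?thesis
      by (intro via_connected quasiconvex_connected)
  next
    assume mid: "approximate_midpoint_property TYPE('a)"
    show ?thesis
    proof (rule doubling_measureI[OF M assms(2)])
      show "C * C > 0"
        using C by simp
    next
      fix r :: real and x y :: 'a
      assume r: "r > 0" and "dist x y < 2 * r"
      \<comment> \<open>This slack serves as \<open>\<epsilon>\<close>: added to
        \<open>dist x y / 2\<close> it gives exactly \<open>r\<close>, so both steps through the
        midpoint are shorter than \<open>r\<close>.\<close>
      then have "r - dist x y / 2 > 0"
        by simp
      then obtain z where "dist x z < (r - dist x y / 2) + dist x y / 2"
        "dist z y < (r - dist x y / 2) + dist x y / 2"
        using mid unfolding approximate_midpoint_property_def by blast
      then have z: "dist x z < r" "dist z y < r"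
        by simp_all
      have "emeasure M (ball y r) \<le> ennreal C * emeasure M (ball z r)"
        using step[OF r z(2)] .
      also have "\<dots> \<le> ennreal C * (ennreal C * emeasure M (ball x r))"
        using step[OF r z(1)] by (rule mult_left_mono) simp
      finally show "emeasure M (ball y r) \<le> ennreal (C * C) * emeasure M (ball x r)"
        using C by (simp add: ennreal_mult mult.assoc)
    qed auto
  qed
qed

end
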